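(* Let $q,l,r$ be integers with $q\ge1$, $l\ge1$, $2r\ge q$ and $q+1\ge l+r$. Let $\mathcal{Q}=\{1,\ldots,l-1\}\cup\{q-r+1,\ldots,q-1,q\}$ (so $\mathcal{Q}=\{q-r+1,\ldots,q-1,q\}$ if $l=1$). Then for all integers $n$ and $k$, $$B_n=\delta_{n,0}+B_{n-1}+B_{n-q-1}+\sum_{j=0}^{q-l-r}f^{(l)}_j\,B_{n-l-q-1-j},$$ $$B_{n,k}=\delta_{n,0}\delta_{k,0}+B_{n-1,k}+B_{n-q-1,k-1}+\sum_{j=0}^{q-l-r}\ \sum_{i=0}^{\lfloor j/l\rfloor}\binom{j-(l-1)i}{i}B_{n-l-q-1-j,\,k-2-i},$$ where $f^{(l)}_j$ is defined by $f^{(l)}_j=f^{(l)}_{j-1}+f^{(l)}_{j-l}+\delta_{j,0}$ with $f^{(l)}_j=0$ for $j<0$. The sums over $j$ are omitted if $q+1=l+r$.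
   Context: $\delta_{i,j}$ is $1$ if $i=j$ and $0$ otherwise. An $N$-board is a linear array of $N$ unit square cells, numbered $1,\ldots,N$ from left to right. A square is a $1\times1$ tile. The comb corresponding to $\mathcal{Q}$ (where $q=\max\mathcal{Q}$) is a tile of length $q+1$ with cells numbered $0,1,\ldots,q$ from left to right, in which cell $0$ is filled and cell $i$ ($1\le i\le q$) is filled if and only if $i\in\mathcal{Q}$; unfilled cells are gaps and are not part of the tile. A restricted-overlap tiling of a board is a placement of tiles on the board (each tile lying entirely within the board) such that every cell of the board is covered by a filled cell of at least one tile, and the leftmost cell of each tile is not covered by any other tile; filled cells that are not the leftmost cells of their tiles are allowed to overlap one another. A tiling is determined by which tiles are placed at which positions. $B_n$ is the number of restricted-overlap tilings of an $n$-board using squares and combs corresponding to $\mathcal{Q}$, and $B_{n,k}$ is the number of such tilings that use exactly $k$ combs. By convention $B_0=B_{0,0}=1$, $B_n=0$ for $n<0$, and $B_{n,k}=0$ if $n<0$, $k<0$ or $n<k$. *)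

theory Defs
  imports Complex_Main
begin

datatype kind = Square | Comb

(* A placed tile is its kind together with the board cell occupied by its leftmost cell. *)
type_synonym tile = "kind \<times> int"

definition leftmost :: "tile \<Rightarrow> int" where
  "leftmost t = snd t"

fun filled_cells :: "int set \<Rightarrow> tile \<Rightarrow> int set" where
  "filled_cells Q (Square, p) = {p}"
| "filled_cells Q (Comb, p) = insert p ((\<lambda>i. p + i) ` Q)"

(* Cells spanned by a tile, gaps included; Q is meant to be a finite nonempty set of
   positive integers, so that the comb has length Max Q + 1. *)
fun span_cells :: "int set \<Rightarrow> tile \<Rightarrow> int set" where
  "span_cells Q (Square, p) = {p}"
| "span_cells Q (Comb, p) = {p .. p + Max Q}"

definition restricted_overlap_tiling :: "int set \<Rightarrow> int \<Rightarrow> tile set \<Rightarrow> bool" where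
  "restricted_overlap_tiling Q n T \<longleftrightarrow>
     (\<forall>t\<in>T. span_cells Q t \<subseteq> {1..n}) \<and>
     {1..n} \<subseteq> (\<Union>t\<in>T. filled_cells Q t) \<and>
     (\<forall>t\<in>T. \<forall>t'\<in>T. t' \<noteq> t \<longrightarrow> leftmost t \<notin> filled_cells Q t')"

definition num_combs :: "tile set \<Rightarrow> int" where
  "num_combs T = int (card {t \<in> T. fst t = Comb})"

definition B :: "int set \<Rightarrow> int \<Rightarrow> int" where
  "B Q n = (if n < 0 then 0 else int (card {T. restricted_overlap_tiling Q n T}))"

(* For k < 0 or n < k there are no such tilings, see Bk_eq_0 below. *)
definition Bk :: "int set \<Rightarrow> int \<Rightarrow> int \<Rightarrow> int" where
  "Bk Q n k = (if n < 0 then 0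
     else int (card {T. restricted_overlap_tiling Q n T \<and> num_combs T = k}))"

(* The guard l < 1 only serves termination; fseq_rec is the intended recurrence. *)
function fseq :: "int \<Rightarrow> int \<Rightarrow> int" where
  "fseq l j = (if l < 1 \<or> j < 0 then 0
     else fseq l (j - 1) + fseq l (j - l) + of_bool (j = 0))"
  by auto
termination
  by (relation "measure (\<lambda>(l, j). nat (j + 1))") auto

declare fseq.simps [simp del]

lemma fseq_neg: "j < 0 \<Longrightarrow> fseq l j = 0"
  by (subst fseq.simps) simp

lemma fseq_rec:
  assumes "l \<ge> 1"
  shows "fseq l j = fseq l (j - 1) + fseq l (j - l) + of_bool (j = 0)"
proof (cases "j < 0")
  case True
  with assms show ?thesis by (simp add: fseq_neg)
next
  case False
  with assms show ?thesis by (subst fseq.simps) simp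
qed

lemma tile_leftmost_in_span:
  assumes "restricted_overlap_tiling Q n T" "t \<in> T" "Q \<noteq> {}" "finite Q" "\<forall>i\<in>Q. i \<ge> 1"
  shows "leftmost t \<in> {1..n}"
proof -
  have "Max Q \<ge> 1" using assms(3-5) by simp
  then have "leftmost t \<in> span_cells Q t"
    by (cases "(Q, t)" rule: span_cells.cases) (auto simp: leftmost_def)
  then show ?thesis using assms(1,2) unfolding restricted_overlap_tiling_def by blast
qed

lemma Bk_eq_0:
  assumes "Q \<noteq> {}" "finite Q" "\<forall>i\<in>Q. i \<ge> 1" and k: "k < 0 \<or> n < k"
  shows "Bk Q n k = 0"
proof (cases "n < 0")
  case False
  have "num_combs T \<noteq> k" if T: "restricted_overlap_tiling Q n T" for T
  proof -
    have "card {t \<in> T. fst t = Comb} \<le> card {1..n}"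
    proof (rule card_inj_on_le)
      show "inj_on snd {t \<in> T. fst t = Comb}"
        by (auto simp: inj_on_def)
      show "snd ` {t \<in> T. fst t = Comb} \<subseteq> {1..n}"
        using tile_leftmost_in_span[OF T _ assms(1-3)] by (auto simp: leftmost_def)
    qed simp
    with False have "0 \<le> num_combs T" "num_combs T \<le> n"
      by (auto simp: num_combs_def)
    with k show ?thesis by auto
  qed
  then have "{T. restricted_overlap_tiling Q n T \<and> num_combs T = k} = {}" by blast
  then show ?thesis unfolding Bk_def by (simp only: card.empty) simp
qed (simp add: Bk_def)

lemma tiling_empty_board:
  assumes "Q \<noteq> {}" "finite Q" "\<forall>i\<in>Q. i \<ge> 1"
  shows "restricted_overlap_tiling Q 0 T \<longleftrightarrow> T = {}"
proof
  assume "restricted_overlap_tiling Q 0 T"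
  from tile_leftmost_in_span[OF this _ assms] show "T = {}" by auto
qed (simp add: restricted_overlap_tiling_def)

lemma B_0:
  assumes "Q \<noteq> {}" "finite Q" "\<forall>i\<in>Q. i \<ge> 1"
  shows "B Q 0 = 1" "Bk Q 0 0 = 1"
proof -
  have "{T. T = ({} :: tile set) \<and> num_combs T = 0} = {{}}"
    by (auto simp: num_combs_def)
  then show "Bk Q 0 0 = 1"
    by (simp add: Bk_def tiling_empty_board[OF assms])
  have "{T. restricted_overlap_tiling Q 0 T} = {{}}"
    by (auto simp: tiling_empty_board[OF assms])
  then show "B Q 0 = 1"
    unfolding B_def by (simp only:) simp
qed

end

theory Submission
  imports Defs
begin

text \<open>
  A restricted-overlap tiling is determined by the set of the positions of its combs, and the sets
  that occur are those subsets of {1, ..., n - q} in which no two elements differ by an element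
  of Q. If cell 1 carries a comb, let H be the set of comb positions in {1, ..., q + 1}. Since
  2 r \<ge> q, all further combs start at max H + q + 1 or later, where they are not restricted
  by H, which leaves a tiling of a board of length n - q - max H. Either H = {1} or
  H = {1} \<union> U \<union> {l + 1 + j}, where U \<subseteq> {l + 1, ..., j + 1} is an arbitrary set whose elements
  are at least l apart; the number of such U of size i is a binomial coefficient. Summation of the
  recurrence over k gives the one for B.
\<close>

section \<open>Finite sets of integers that avoid prescribed differences\<close>

text \<open>With \<open>D = Q\<close> these are the admissible sets of comb positions, with
  \<open>D = {1..l - 1}\<close> the sets whose elements are at least \<open>l\<close> apart. The
  index \<open>k\<close> is an integer, so that \<open>k - int (card H)\<close> may become negative,
  where the family is empty.\<close>

definition indep :: "int set \<Rightarrow> int set \<Rightarrow> int \<Rightarrow> int set set" where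
  "indep D A k = {S. S \<subseteq> A \<and> int (card S) = k \<and> (\<forall>x\<in>S. \<forall>y\<in>S. y - x \<notin> D)}"

lemma finite_indep: "finite A \<Longrightarrow> finite (indep D A k)"
  by (rule finite_subset[of _ "Pow A"]) (auto simp: indep_def)

lemma indep_0: "finite A \<Longrightarrow> indep D A 0 = {{}}"
  by (auto simp: indep_def dest: finite_subset)

lemma indep_empty: "indep D {} k = (if k = 0 then {{}} else {})"
  by (auto simp: indep_def)

lemma card_indep_shift: "card (indep D {a + c..b + c} k) = card (indep D {a..b} k)"
proof -
  have "bij_betw ((`) ((+) c)) (indep D {a..b} k) (indep D {a + c..b + c} k)"
  proof (rule bij_betw_byWitness[where f' = "(`) ((+) (- c))"])
    show "(`) ((+) c) ` indep D {a..b} k \<subseteq> indep D {a + c..b + c} k"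
      by (auto simp: indep_def card_image inj_on_def)
    show "(`) ((+) (- c)) ` indep D {a + c..b + c} k \<subseteq> indep D {a..b} k"
    proof (rule image_subsetI)
      fix S assume S: "S \<in> indep D {a + c..b + c} k"
      have "card ((+) (- c) ` S) = card S" by (simp add: card_image inj_on_def)
      with S show "(+) (- c) ` S \<in> indep D {a..b} k"
        by (auto simp: indep_def)
    qed
  qed (auto simp: image_image)
  then show ?thesis by (simp add: bij_betw_same_card)
qed

text \<open>Once the part \<open>H\<close> inside \<open>{1..b}\<close> is fixed, every position
  strictly between \<open>b\<close> and \<open>c\<close> is excluded by an element of
  \<open>H\<close>, and from \<open>c\<close> on \<open>H\<close> excludes nothing (differences
  taken backwards are negative, hence not in \<open>D\<close>). So removing \<open>H\<close> leaves
  an arbitrary independent subset of \<open>{c..m}\<close>, which is then translated to start at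
  1.\<close>

lemma card_indep_fixed_head:
  assumes D: "D \<subseteq> {1..}"
    and H: "H \<subseteq> {1..b}" "H \<subseteq> {..m}" "\<And>x y. x \<in> H \<Longrightarrow> y \<in> H \<Longrightarrow> y - x \<notin> D"
    and c: "0 \<le> b" "b < c"
    and blocked: "\<And>y. b < y \<Longrightarrow> y < c \<Longrightarrow> \<exists>x\<in>H. y - x \<in> D"
    and allowed: "\<And>x y. x \<in> H \<Longrightarrow> c \<le> y \<Longrightarrow> y - x \<notin> D"
  shows "card {S \<in> indep D {1..m} k. S \<inter> {1..b} = H}
       = card (indep D {1..m - c + 1} (k - int (card H)))"
proof -
  have finH: "finite H" using H(1) by (rule finite_subset) simp
  have behind: "x - y \<notin> D" if "x \<in> H" "c \<le> y" for x y
  proof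
    assume "x - y \<in> D"
    then have "x - y \<ge> 1" using D by auto
    moreover have "x \<le> b" using that H(1) by auto
    ultimately show False using that c by simp
  qed
  have "bij_betw ((\<union>) H) (indep D {c..m} (k - int (card H)))
          {S \<in> indep D {1..m} k. S \<inter> {1..b} = H}"
  proof (rule bij_betw_byWitness[where f' = "\<lambda>S. S - H"])
    have ge: "y \<ge> c" if "S \<in> indep D {1..m} k" "S \<inter> {1..b} = H" "y \<in> S" "y \<notin> H" for S y
    proof (rule ccontr)
      assume "\<not> c \<le> y"
      moreover have "y > b" using that by (auto simp: indep_def)
      ultimately obtain x where "x \<in> H" "y - x \<in> D" using blocked by force
      moreover have "x \<in> S" using that \<open>x \<in> H\<close> by auto
      ultimately show False using that by (auto simp: indep_def)
    qed
    have disj: "H \<inter> S = {}" if "S \<subseteq> {c..m}" for S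
      using that H(1) c by fastforce
    show "\<forall>S\<in>indep D {c..m} (k - int (card H)). H \<union> S - H = S"
      using disj by (auto simp: indep_def)
    show "\<forall>S\<in>{S \<in> indep D {1..m} k. S \<inter> {1..b} = H}. H \<union> (S - H) = S"
      by auto
    show "(\<union>) H ` indep D {c..m} (k - int (card H)) \<subseteq> {S \<in> indep D {1..m} k. S \<inter> {1..b} = H}"
    proof (rule image_subsetI)
      fix S assume S: "S \<in> indep D {c..m} (k - int (card H))"
      have sub: "S \<subseteq> {c..m}" using S by (auto simp: indep_def)
      have "finite S" using sub by (rule finite_subset) simp
      then have "int (card (H \<union> S)) = k"
        using S finH disj[OF sub] by (simp add: card_Un_disjoint indep_def)
      moreover have "H \<union> S \<subseteq> {1..m}" using sub H(1,2) c by fastforce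
      moreover have "\<forall>x\<in>H \<union> S. \<forall>y\<in>H \<union> S. y - x \<notin> D"
        using H(3) S sub allowed behind by (auto simp: indep_def subset_iff)
      moreover have "(H \<union> S) \<inter> {1..b} = H" using sub H(1) c by fastforce
      ultimately show "H \<union> S \<in> {S \<in> indep D {1..m} k. S \<inter> {1..b} = H}"
        by (auto simp: indep_def)
    qed
    show "(\<lambda>S. S - H) ` {S \<in> indep D {1..m} k. S \<inter> {1..b} = H} \<subseteq> indep D {c..m} (k - int (card H))"
    proof (rule image_subsetI)
      fix S assume S: "S \<in> {S \<in> indep D {1..m} k. S \<inter> {1..b} = H}"
      then have "finite S" "H \<subseteq> S" by (auto simp: indep_def intro: finite_subset)
      then have "int (card (S - H)) = int (card S) - int (card H)"
        by (simp add: card_Diff_subset finH card_mono of_nat_diff)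
      moreover have "S - H \<subseteq> {c..m}"
      proof
        fix y assume y: "y \<in> S - H"
        then have "c \<le> y" using S by (intro ge[of S]) auto
        then show "y \<in> {c..m}" using S y by (auto simp: indep_def)
      qed
      ultimately show "S - H \<in> indep D {c..m} (k - int (card H))"
        using S by (auto simp: indep_def)
    qed
  qed
  then show ?thesis
    using card_indep_shift[of D 1 "c - 1" "m - c + 1"] by (auto dest: bij_betw_same_card)
qed

lemma card_indep_split:
  assumes "1 \<le> m"
  shows "int (card (indep D {1..m} k))
       = int (card (indep D {1..m - 1} k)) + int (card {S \<in> indep D {1..m} k. 1 \<in> S})"
proof -
  have "{1..m} = insert 1 {2..m}" using assms by auto
  then have "{S \<in> indep D {1..m} k. 1 \<notin> S} = indep D {2..m} k"
    by (auto simp: indep_def)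
  moreover have "card (indep D {1..m} k)
      = card {S \<in> indep D {1..m} k. 1 \<in> S} + card {S \<in> indep D {1..m} k. 1 \<notin> S}"
    by (subst card_Un_disjoint[symmetric])
      (auto simp: finite_indep intro: arg_cong[where f = card])
  ultimately have "card (indep D {1..m} k)
      = card (indep D {2..m} k) + card {S \<in> indep D {1..m} k. 1 \<in> S}"
    by simp
  then show ?thesis using card_indep_shift[of D 1 1 "m - 1" k] by simp
qed

section \<open>Counting sets with gaps at least \<open>l\<close>; the sequence
  \<open>fseq\<close>\<close>

text \<open>Pascal's rule for the upper entry \<open>t + 1\<close>, where
  \<open>t = j - 1 - (l - 1) * i\<close>; both binomials on the right have upper entry
  \<open>t\<close>.\<close>

lemma gap_binomial_rec:
  fixes l j i :: int
  assumes "1 \<le> l" "l \<le> j" "1 \<le> i"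
  shows "nat (j - (l - 1) * i) choose nat i
       = (nat (j - 1 - (l - 1) * i) choose nat i) + (nat (j - l - (l - 1) * (i - 1)) choose nat (i - 1))"
proof -
  define t where "t = j - 1 - (l - 1) * i"
  have t: "j - (l - 1) * i = t + 1" "j - l - (l - 1) * (i - 1) = t"
    by (simp_all add: t_def algebra_simps)
  have i: "nat i = Suc (nat (i - 1))" using assms by simp
  show ?thesis
  proof (cases "t \<ge> 0")
    case True
    then have "nat (t + 1) = Suc (nat t)" by simp
    then show ?thesis unfolding t t_def[symmetric] i by simp
  next
    case False
    \<comment> \<open>For negative \<open>t\<close>, \<open>nat\<close> turns all upper entries into
      0. The identity then holds because both lower entries are positive; it would fail for
      \<open>i = 1\<close>, but in that case \<open>t = j - l \<ge> 0\<close>.\<close>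
    have "i \<noteq> 1" using False assms by (auto simp: t_def)
    then have "nat (i - 1) = Suc (nat (i - 2))" using assms by simp
    then show ?thesis using False unfolding t t_def[symmetric] i by simp
  qed
qed

lemma gap_binomial_eq_0:
  fixes l j i :: int
  assumes "1 \<le> i" "j < l * i"
  shows "nat (j - (l - 1) * i) choose nat i = 0"
proof (rule binomial_eq_0)
  have "j - (l - 1) * i < i" using assms by (simp add: algebra_simps)
  then show "nat (j - (l - 1) * i) < nat i" using assms by linarith
qed

text \<open>Induction on \<open>j\<close> by whether 1 is chosen: if not, the interval loses one
  cell; if so, the next element is at least \<open>l + 1\<close> and the interval loses
  \<open>l\<close> cells. This is the recursion of \<open>gap_binomial_rec\<close>. The length
  \<open>j + 1 - l\<close> is that of \<open>{l + 1..j + 1}\<close>, the room for \<open>U\<close>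
  in a head with largest element \<open>l + 1 + j\<close>.\<close>

lemma card_indep_interval:
  fixes l j i :: int
  assumes l: "1 \<le> l" and "0 \<le> j" "0 \<le> i"
  shows "card (indep {1..l - 1} {1..j + 1 - l} i) = nat (j - (l - 1) * i) choose nat i"
  using assms(2,3)
proof (induction "nat j" arbitrary: j i rule: less_induct)
  case less
  show ?case
  proof (cases "i = 0 \<or> j < l")
    case True
    then show ?thesis
    proof (cases "i = 0")
      case False
      then have "j < l * i" using True less.prems l
        by (smt (verit) mult_le_cancel_left1)
      then show ?thesis using True False less.prems
        by (simp add: indep_empty gap_binomial_eq_0)
    qed (simp add: indep_0)
  next
    case False
    then have i: "i \<ge> 1" and j: "l \<le> j" using less.prems by auto
    have "{S \<in> indep {1..l - 1} {1..j + 1 - l} i. 1 \<in> S}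
        = {S \<in> indep {1..l - 1} {1..j + 1 - l} i. S \<inter> {1..1} = {1}}" by auto
    \<comment> \<open>Here \<open>H = {1}\<close>, \<open>b = 1\<close> and
      \<open>c = l + 1\<close>: the element 1 excludes exactly \<open>{2..l}\<close>.\<close>
    also have "card \<dots> = card (indep {1..l - 1} {1..(j + 1 - l) - (l + 1) + 1} (i - int (card {1::int})))"
      by (rule card_indep_fixed_head) (use j l in auto)
    also have "\<dots> = nat (j - l - (l - 1) * (i - 1)) choose nat (i - 1)"
      using less.hyps[of "j - l" "i - 1"] i j l by (simp add: algebra_simps)
    finally have "int (card (indep {1..l - 1} {1..j + 1 - l} i))
        = int (card (indep {1..l - 1} {1..j - 1 + 1 - l} i))
        + int (nat (j - l - (l - 1) * (i - 1)) choose nat (i - 1))"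
      using card_indep_split[of "j + 1 - l" "{1..l - 1}" i] j by (simp add: algebra_simps)
    also have "card (indep {1..l - 1} {1..j - 1 + 1 - l} i) = nat (j - 1 - (l - 1) * i) choose nat i"
      using i j l by (intro less.hyps) auto
    finally show ?thesis using gap_binomial_rec[OF l j i] by simp
  qed
qed

text \<open>Summing \<open>gap_binomial_rec\<close> over \<open>i\<close> gives the recurrence of
  \<open>fseq\<close>. The common upper limit \<open>N\<close> lets the sums for \<open>j\<close>,
  \<open>j - 1\<close> and \<open>j - l\<close> range over the same indices.\<close>

lemma fseq_eq_sum_upto:
  fixes l j N :: int
  assumes l: "1 \<le> l" and "0 \<le> j" "j \<le> N"
  shows "fseq l j = (\<Sum>i = 0..N. int (nat (j - (l - 1) * i) choose nat i))"
  using assms(2,3)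
proof (induction "nat j" arbitrary: j rule: less_induct)
  case less
  have N: "{0..N} = insert 0 {1..N}" using less.prems by auto
  show ?case
  proof (cases "j < l")
    case True
    \<comment> \<open>For \<open>j < l\<close> only the term \<open>i = 0\<close> survives, so that
      sum and \<open>fseq l j\<close> are both 1.\<close>
    have zero: "nat (j' - (l - 1) * i) choose nat i = 0" if "i \<in> {1..N}" "j' < l" for i j'
    proof -
      have "l * 1 \<le> l * i" using that l by (intro mult_left_mono) auto
      then show ?thesis using that by (intro gap_binomial_eq_0) auto
    qed
    have "fseq l j = 1"
    proof (cases "j = 0")
      case False
      have "fseq l (j - 1) = 1"
        using less.hyps[of "j - 1"] False less.prems True by (simp add: N zero)
      then show ?thesis using False True by (simp add: fseq_rec[OF l, of j] fseq_neg)
    qed (use l in \<open>simp add: fseq_rec[OF l, of 0] fseq_neg\<close>)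
    then show ?thesis using True by (simp add: N zero)
  next
    case False
    then have j: "l \<le> j" by simp
    have "(\<Sum>i = 0..N. int (nat (j - (l - 1) * i) choose nat i))
        = 1 + (\<Sum>i = 1..N. int (nat (j - 1 - (l - 1) * i) choose nat i))
            + (\<Sum>i = 1..N. int (nat (j - l - (l - 1) * (i - 1)) choose nat (i - 1)))"
    proof -
      have "(\<Sum>i = 1..N. int (nat (j - (l - 1) * i) choose nat i))
          = (\<Sum>i = 1..N. int (nat (j - 1 - (l - 1) * i) choose nat i)
              + int (nat (j - l - (l - 1) * (i - 1)) choose nat (i - 1)))"
        by (intro sum.cong refl) (subst gap_binomial_rec[OF l j], auto)
      then show ?thesis by (simp only: N) (simp add: sum.distrib)
    qed
    also have "1 + (\<Sum>i = 1..N. int (nat (j - 1 - (l - 1) * i) choose nat i)) = fseq l (j - 1)"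
      using less.hyps[of "j - 1"] less.prems j l by (simp add: N)
    also have "(\<Sum>i = 1..N. int (nat (j - l - (l - 1) * (i - 1)) choose nat (i - 1)))
        = (\<Sum>i = 0..N - 1. int (nat (j - l - (l - 1) * i) choose nat i))"
      by (rule sum.reindex_bij_witness[where i = "\<lambda>i. i + 1" and j = "\<lambda>i. i - 1"]) auto
    also have "\<dots> = (\<Sum>i = 0..N. int (nat (j - l - (l - 1) * i) choose nat i))"
    proof -
      \<comment> \<open>The index shift stopped at \<open>N - 1\<close>; this inequality makes the
        missing term \<open>i = N\<close> vanish.\<close>
      have "N < 1 \<or> j - l < l * N"
      proof -
        have "j - l < N" using j l less.prems by simp
        moreover have "1 * N \<le> l * N" using l less.prems by (intro mult_right_mono) auto
        ultimately show ?thesis by simp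
      qed
      moreover have "{0..N} = insert N {0..N - 1}" using less.prems by auto
      moreover have "N \<ge> 1" using j l less.prems by simp
      ultimately show ?thesis by (simp add: gap_binomial_eq_0)
    qed
    also have "\<dots> = fseq l (j - l)"
      using less.hyps[of "j - l"] less.prems j l by simp
    finally show ?thesis using j l by (simp add: fseq_rec[OF l, of j])
  qed
qed

lemma less_mult_if_div_less:
  fixes l j i :: int
  assumes "1 \<le> l" "j div l < i"
  shows "j < l * i"
proof -
  have "l * (j div l + 1) \<le> l * i" using assms by (intro mult_left_mono) auto
  moreover have "l * (j div l) + j mod l = j" "j mod l < l" using assms by simp_all
  ultimately show ?thesis by (simp only: distrib_left)
qed

lemma fseq_eq_sum:
  fixes l j :: int
  assumes l: "1 \<le> l" and j: "0 \<le> j"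
  shows "fseq l j = (\<Sum>i = 0..j div l. int (nat (j - (l - 1) * i) choose nat i))"
proof -
  have "fseq l j = (\<Sum>i = 0..j. int (nat (j - (l - 1) * i) choose nat i))"
    using fseq_eq_sum_upto[OF l j order_refl] .
  also have "\<dots> = (\<Sum>i = 0..j div l. int (nat (j - (l - 1) * i) choose nat i))"
  proof (rule sum.mono_neutral_right)
    show "{0..j div l} \<subseteq> {0..j}"
      using l j zdiv_mono2[of j 1 l] by auto
    show "\<forall>i\<in>{0..j} - {0..j div l}. int (nat (j - (l - 1) * i) choose nat i) = 0"
    proof
      fix i assume i: "i \<in> {0..j} - {0..j div l}"
      then have "j div l < i" by auto
      then have "j < l * i" using l by (intro less_mult_if_div_less)
      moreover have "1 \<le> i" using i pos_imp_zdiv_nonneg_iff[of l j] l j by auto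
      ultimately show "int (nat (j - (l - 1) * i) choose nat i) = 0"
        by (simp add: gap_binomial_eq_0)
    qed
  qed simp
  finally show ?thesis .
qed

section \<open>Tilings as sets of comb positions\<close>

text \<open>\<open>combs\<close> and \<open>tiling\<close> are mutually inverse: the combs force the
  squares, the overlap rule between two combs says that their positions do not differ by an element
  of \<open>Q\<close>, and a comb fits on the board iff it starts in
  \<open>{1..n - Max Q}\<close>.\<close>

lemma Bk_eq_card_indep:
  assumes Q: "Q \<noteq> {}" "finite Q" "Q \<subseteq> {1..}" and n: "0 \<le> n"
  shows "Bk Q n k = int (card (indep Q {1..n - Max Q} k))"
proof -
  define covered where "covered S = (\<Union>p\<in>S. filled_cells Q (Comb, p))" for S :: "int set"
  define tiling where "tiling S = Pair Comb ` S \<union> Pair Square ` ({1..n} - covered S)" for S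
  define combs where "combs T = {p. (Comb, p) \<in> T}" for T :: "tile set"
  have Max: "1 \<le> Max Q" "\<And>d. d \<in> Q \<Longrightarrow> 1 \<le> d"
    using Max_in[OF Q(2,1)] Q(3) by auto
  have combs_card: "num_combs T = int (card (combs T))" for T
  proof -
    have "{t \<in> T. fst t = Comb} = Pair Comb ` combs T" by (force simp: combs_def)
    then show ?thesis by (simp add: num_combs_def card_image inj_on_def)
  qed
  have combs_tiling: "combs (tiling S) = S" for S
    by (auto simp: combs_def tiling_def)
  \<comment> \<open>The only cell of a square is its leftmost one, so no comb may cover it;
    conversely, a cell missed by all combs can only be filled by a square.\<close>
  have square: "(Square, p) \<in> T \<longleftrightarrow> p \<in> {1..n} - covered (combs T)"
    if T: "restricted_overlap_tiling Q n T" for T p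
  proof
    assume p: "(Square, p) \<in> T"
    then have "p \<in> {1..n}" using T unfolding restricted_overlap_tiling_def by fastforce
    moreover have "p \<notin> filled_cells Q (Comb, p')" if "(Comb, p') \<in> T" for p'
      using T p that unfolding restricted_overlap_tiling_def leftmost_def
      by (metis Pair_inject kind.distinct(1) snd_conv)
    ultimately show "p \<in> {1..n} - covered (combs T)"
      by (auto simp: covered_def combs_def)
  next
    assume p: "p \<in> {1..n} - covered (combs T)"
    then obtain t where t: "t \<in> T" "p \<in> filled_cells Q t"
      using T unfolding restricted_overlap_tiling_def by blast
    show "(Square, p) \<in> T"
    proof (cases "fst t")
      case Square
      then show ?thesis using t by (cases t) auto
    next
      case Comb
      then have "p \<in> covered (combs T)" using t by (cases t) (auto simp: covered_def combs_def)
      then show ?thesis using p by simp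
    qed
  qed
  have tiling_combs: "tiling (combs T) = T" if T: "restricted_overlap_tiling Q n T" for T
  proof (rule set_eqI)
    fix t
    show "t \<in> tiling (combs T) \<longleftrightarrow> t \<in> T"
    proof (cases t)
      case (Pair x p)
      then show ?thesis using square[OF T, of p] by (cases x) (auto simp: tiling_def combs_def)
    qed
  qed
  have combs_indep: "combs T \<in> indep Q {1..n - Max Q} k"
    if T: "restricted_overlap_tiling Q n T" "num_combs T = k" for T
  proof -
    have "combs T \<subseteq> {1..n - Max Q}"
    proof
      fix p assume "p \<in> combs T"
      then have "{p..p + Max Q} \<subseteq> {1..n}"
        using T unfolding restricted_overlap_tiling_def combs_def by fastforce
      then show "p \<in> {1..n - Max Q}" using Max by auto
    qed
    moreover have "y - x \<notin> Q" if xy: "x \<in> combs T" "y \<in> combs T" for x y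
    proof
      assume yx: "y - x \<in> Q"
      then have "y \<in> filled_cells Q (Comb, x)" by force
      moreover have "x \<noteq> y" using Max(2)[OF yx] by auto
      ultimately show False
        using T xy unfolding restricted_overlap_tiling_def combs_def leftmost_def
        by (metis (no_types, lifting) Pair_inject mem_Collect_eq snd_conv)
    qed
    ultimately show ?thesis using T combs_card by (auto simp: indep_def)
  qed
  have tiling_ok: "restricted_overlap_tiling Q n (tiling S)"
    if S: "S \<in> indep Q {1..n - Max Q} k" for S
    unfolding restricted_overlap_tiling_def
  proof (intro conjI ballI impI)
    fix t assume "t \<in> tiling S"
    then show "span_cells Q t \<subseteq> {1..n}" using S by (auto simp: tiling_def indep_def)
  next
    show "{1..n} \<subseteq> (\<Union>t\<in>tiling S. filled_cells Q t)"
    proof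
      fix p assume p: "p \<in> {1..n}"
      show "p \<in> (\<Union>t\<in>tiling S. filled_cells Q t)"
      proof (cases "p \<in> covered S")
        case True
        then show ?thesis unfolding covered_def tiling_def by blast
      next
        case False
        then have "(Square, p) \<in> tiling S" using p by (auto simp: tiling_def)
        then show ?thesis by force
      qed
    qed
  next
    fix t t' assume t: "t \<in> tiling S" "t' \<in> tiling S" "t' \<noteq> t"
    have sep: "\<And>x y. x \<in> S \<Longrightarrow> y \<in> S \<Longrightarrow> y - x \<notin> Q" using S by (auto simp: indep_def)
    show "leftmost t \<notin> filled_cells Q t'"
    \<comment> \<open>A square \<open>t'\<close> lies on a cell outside all combs. A comb
      \<open>t'\<close> misses all squares by the choice of \<open>tiling\<close>, and the leftmost
      cells of other combs by \<open>sep\<close>.\<close>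
    proof (cases "(Q, t')" rule: span_cells.cases)
      case (1 Q' p')
      then show ?thesis using t by (auto simp: tiling_def covered_def leftmost_def)
    next
      case (2 Q' p')
      then have "p' \<in> S" using t by (auto simp: tiling_def)
      then show ?thesis using t 2 sep by (fastforce simp: tiling_def covered_def leftmost_def)
    qed
  qed
  have "bij_betw tiling (indep Q {1..n - Max Q} k)
      {T. restricted_overlap_tiling Q n T \<and> num_combs T = k}"
    by (rule bij_betw_byWitness[where f' = combs])
      (use combs_indep tiling_ok combs_tiling tiling_combs combs_card in
        \<open>auto simp: indep_def\<close>)
  then show ?thesis using n by (simp add: Bk_def bij_betw_same_card)
qed

section \<open>Summation over the number of combs\<close>

text \<open>The finitely many tilings are grouped by \<open>num_combs\<close>, whose values lie in
  \<open>{0..n}\<close>. Any finite superset \<open>K\<close> is allowed, to accommodate shifted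
  ranges.\<close>

lemma sum_Bk:
  assumes Q: "Q \<noteq> {}" "finite Q" "Q \<subseteq> {1..}" and K: "finite K" "{0..n} \<subseteq> K"
  shows "(\<Sum>k\<in>K. Bk Q n k) = B Q n"
proof (cases "n < 0")
  case False
  let ?T = "{T. restricted_overlap_tiling Q n T}"
  have Q1: "\<forall>i\<in>Q. 1 \<le> i" using Q by auto
  have "?T \<subseteq> Pow ({Square, Comb} \<times> {1..n})"
  proof clarify
    fix T x p assume "restricted_overlap_tiling Q n T" "(x, p) \<in> T"
    from tile_leftmost_in_span[OF this Q(1,2) Q1] show "x \<in> {Square, Comb} \<and> p \<in> {1..n}"
      by (cases x) (auto simp: leftmost_def)
  qed
  then have fin: "finite ?T" by (rule finite_subset) simp
  have "num_combs T \<in> K" if T: "T \<in> ?T" for T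
  \<comment> \<open>A value outside \<open>{0..n}\<close> would make the class of \<open>T\<close>
    empty by \<open>Bk_eq_0\<close>, although it contains \<open>T\<close>.\<close>
  proof (rule ccontr)
    assume "num_combs T \<notin> K"
    then have "num_combs T < 0 \<or> n < num_combs T" using K by (meson atLeastAtMost_iff not_le subset_iff)
    from Bk_eq_0[OF Q(1,2) Q1 this] False
    have "card {T' \<in> ?T. num_combs T' = num_combs T} = 0" by (simp add: Bk_def)
    then show False using fin T by auto
  qed
  then have "(\<Sum>k\<in>K. \<Sum>T\<in>{T \<in> ?T. num_combs T = k}. 1) = (\<Sum>T\<in>?T. 1 :: int)"
    by (intro sum.group fin K) auto
  then show ?thesis using False by (simp add: B_def Bk_def)
qed (simp add: B_def Bk_def)

lemma sum_Bk_shift: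
  assumes Q: "Q \<noteq> {}" "finite Q" "Q \<subseteq> {1..}" and c: "0 \<le> c" "n' \<le> n - c"
  shows "(\<Sum>k = 0..n. Bk Q n' (k - c)) = B Q n'"
proof -
  have "(\<Sum>k = 0..n. Bk Q n' (k - c)) = (\<Sum>k = - c..n - c. Bk Q n' k)"
    by (rule sum.reindex_bij_witness[where i = "\<lambda>k. k + c" and j = "\<lambda>k. k - c"]) auto
  also have "\<dots> = B Q n'" using c by (intro sum_Bk Q) auto
  finally show ?thesis .
qed

section \<open>Heads: the combs starting in the first \<open>q + 1\<close> cells\<close>

context
  fixes q l r :: int and Q :: "int set"
  assumes q: "1 \<le> q" and l: "1 \<le> l" and r: "q \<le> 2 * r" and lr: "l + r \<le> q + 1"
    and Q: "Q = {1..l - 1} \<union> {q - r + 1..q}"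
begin

lemma Q_props: "Q \<noteq> {}" "finite Q" "Q \<subseteq> {1..}" "Max Q = q"
proof -
  have "q \<in> Q" using q r by (auto simp: Q)
  then show "Q \<noteq> {}" by auto
  show fin: "finite Q" by (simp add: Q)
  show "Q \<subseteq> {1..}" using l lr by (auto simp: Q)
  show "Max Q = q" using \<open>q \<in> Q\<close> fin r q lr by (intro Max_eqI) (auto simp: Q)
qed

text \<open>The comb positions among cells 1, ..., q + 1 of a tiling with a comb in cell 1.\<close>

definition heads :: "int set set" where
  "heads = {H. H \<subseteq> {1..q + 1} \<and> 1 \<in> H \<and> (\<forall>x\<in>H. \<forall>y\<in>H. y - x \<notin> Q)}"

lemma finite_heads: "finite heads"
  by (rule finite_subset[of _ "Pow {1..q + 1}"]) (auto simp: heads_def)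

text \<open>The last bound holds since \<open>Max H - 1\<close> is a difference of two elements of
  \<open>H\<close>, is at most \<open>q\<close>, and must avoid the block
  \<open>{q - r + 1..q}\<close>.\<close>

lemma headsD:
  assumes "H \<in> heads"
  shows "finite H" "Max H \<in> H" "\<And>x. x \<in> H \<Longrightarrow> 1 \<le> x \<and> x \<le> Max H" "Max H \<le> q - r + 1"
proof -
  show fin: "finite H" using assms by (auto simp: heads_def intro: finite_subset)
  have ne: "H \<noteq> {}" using assms by (auto simp: heads_def)
  show max: "Max H \<in> H" using fin ne by simp
  show "1 \<le> x \<and> x \<le> Max H" if "x \<in> H" for x
    using that fin assms by (auto simp: heads_def)
  have "Max H - 1 \<notin> Q" "Max H \<le> q + 1" using assms max by (auto simp: heads_def)
  then show "Max H \<le> q - r + 1" by (auto simp: Q)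
qed

lemma card_indep_head:
  assumes H: "H \<in> heads"
  shows "int (card {S \<in> indep Q {1..n - q} k. S \<inter> {1..q + 1} = H})
       = Bk Q (n - q - Max H) (k - int (card H))"
proof (cases "Max H \<le> n - q")
  case True
  note h = headsD[OF H]
  have "card {S \<in> indep Q {1..n - q} k. S \<inter> {1..q + 1} = H}
      = card (indep Q {1..n - q - (Max H + q + 1) + 1} (k - int (card H)))"
  proof (rule card_indep_fixed_head)
    \<comment> \<open>The last comb alone blocks these positions: \<open>y - Max H\<close> is at
      most \<open>q\<close> and at least \<open>r + 1\<close>, and
      \<open>r + 1 \<ge> q - r + 1\<close> because \<open>2 * r \<ge> q\<close>.\<close>
    show "\<exists>x\<in>H. y - x \<in> Q" if "q + 1 < y" "y < Max H + q + 1" for y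
    proof
      show "y - Max H \<in> Q" using that h(4) r by (auto simp: Q)
    qed (rule h)
    show "y - x \<notin> Q" if "x \<in> H" "Max H + q + 1 \<le> y" for x y
      using that h(3)[of x] lr r q by (auto simp: Q)
    show "q + 1 < Max H + q + 1" using h(2) h(3)[of "Max H"] by simp
    show "H \<subseteq> {..n - q}" using h(3) True by force
  qed (use H Q_props q in \<open>auto simp: heads_def\<close>)
  then show ?thesis using True
    by (simp add: Bk_eq_card_indep[OF Q_props(1-3)] Q_props(4) algebra_simps)
\<comment> \<open>If the last comb of \<open>H\<close> does not fit, no set has head
  \<open>H\<close>, and on the right the board length is negative.\<close>
next
  case False
  then have "{S \<in> indep Q {1..n - q} k. S \<inter> {1..q + 1} = H} = {}"
    using headsD(2)[OF H] by (force simp: indep_def)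
  then have "card {S \<in> indep Q {1..n - q} k. S \<inter> {1..q + 1} = H} = 0" by (simp only: card.empty)
  then show ?thesis using False by (simp add: Bk_def)
qed

lemma Bk_eq_sum_heads:
  assumes n: "1 \<le> n"
  shows "Bk Q n k = Bk Q (n - 1) k + (\<Sum>H\<in>heads. Bk Q (n - q - Max H) (k - int (card H)))"
proof (cases "n \<le> q")
  case True
  have "(\<Sum>H\<in>heads. Bk Q (n - q - Max H) (k - int (card H))) = 0"
  proof (rule sum.neutral, rule ballI)
    fix H assume "H \<in> heads"
    from headsD(2,3)[OF this] have "1 \<le> Max H" by blast
    then show "Bk Q (n - q - Max H) (k - int (card H)) = 0" using True by (simp add: Bk_def)
  qed
  then show ?thesis using True n
    by (simp add: Bk_eq_card_indep[OF Q_props(1-3)] Q_props(4))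
next
  case False
  let ?S = "{S \<in> indep Q {1..n - q} k. 1 \<in> S}"
  \<comment> \<open>The sets containing 1 are grouped by their head
    \<open>S \<inter> {1..q + 1}\<close>.\<close>
  have "(\<Sum>H\<in>heads. \<Sum>S\<in>{S \<in> ?S. S \<inter> {1..q + 1} = H}. 1) = (\<Sum>S\<in>?S. 1 :: int)"
    by (intro sum.group finite_heads) (use q in \<open>auto simp: finite_indep heads_def indep_def\<close>)
  moreover have "(\<Sum>S\<in>{S \<in> ?S. S \<inter> {1..q + 1} = H}. 1) = Bk Q (n - q - Max H) (k - int (card H))"
    if H: "H \<in> heads" for H
  proof -
    have "{S \<in> ?S. S \<inter> {1..q + 1} = H} = {S \<in> indep Q {1..n - q} k. S \<inter> {1..q + 1} = H}"
      using H by (auto simp: heads_def)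
    then show ?thesis using card_indep_head[OF H] by simp
  qed
  ultimately have "int (card ?S) = (\<Sum>H\<in>heads. Bk Q (n - q - Max H) (k - int (card H)))"
    by simp
  then show ?thesis using card_indep_split[of "n - q" Q k] False n
    by (simp add: Bk_eq_card_indep[OF Q_props(1-3)] Q_props(4) algebra_simps)
qed

text \<open>All differences within a head are at most \<open>q - r\<close>, so only the block
  \<open>{1..l - 1}\<close> of \<open>Q\<close> constrains it. Hence a head other than
  \<open>{1}\<close> corresponds to a triple \<open>(j, i, U)\<close> with
  \<open>Max H = l + 1 + j\<close> and \<open>U\<close> the \<open>i\<close> elements strictly
  between 1 and \<open>Max H\<close>. If \<open>q + 1 = l + r\<close>, the range of \<open>j\<close>
  is empty and \<open>{1}\<close> is the only head.\<close>

lemma sum_heads: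
  fixes g :: "int \<Rightarrow> int \<Rightarrow> int"
  shows "(\<Sum>H\<in>heads. g (Max H) (int (card H)))
       = g 1 1 + (\<Sum>j = 0..q - l - r. \<Sum>i = 0..j div l.
           int (nat (j - (l - 1) * i) choose nat i) * g (l + 1 + j) (i + 2))"
proof -
  let ?U = "\<lambda>j i. indep {1..l - 1} {l + 1..j + 1} i"
  have cardU: "card (?U j i) = nat (j - (l - 1) * i) choose nat i" if "0 \<le> j" "0 \<le> i" for j i
    using card_indep_shift[of "{1..l - 1}" 1 l "j + 1 - l" i] card_indep_interval[OF l that]
    by (simp add: algebra_simps)
  define X where "X = (SIGMA j:{0..q - l - r}. SIGMA i:{0..j div l}. ?U j i)"
  define \<phi> where "\<phi> = (\<lambda>(j :: int, i :: int, U). insert 1 (insert (l + 1 + j) U))"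
  define \<psi> where "\<psi> = (\<lambda>H. (Max H - l - 1, int (card H) - 2, H - {1, Max H}))"
  have \<phi>: "Max (\<phi> (j, i, U)) = l + 1 + j" "int (card (\<phi> (j, i, U))) = i + 2"
      "\<phi> (j, i, U) \<in> heads - {{1}}" "\<psi> (\<phi> (j, i, U)) = (j, i, U)"
    if "(j, i, U) \<in> X" for j i U
  proof -
    have j: "0 \<le> j" "j \<le> q - l - r" and U: "U \<subseteq> {l + 1..j + 1}" "int (card U) = i"
      and sep: "\<And>x y. x \<in> U \<Longrightarrow> y \<in> U \<Longrightarrow> y - x \<notin> {1..l - 1}"
      using that by (auto simp: X_def indep_def)
    have fin: "finite U" using U(1) by (rule finite_subset) simp
    have notin: "1 \<notin> U" "l + 1 + j \<notin> U" using U l by auto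
    show max: "Max (\<phi> (j, i, U)) = l + 1 + j"
      by (rule Max_eqI) (use U fin l j in \<open>auto simp: \<phi>_def\<close>)
    show card: "int (card (\<phi> (j, i, U))) = i + 2"
      using U fin notin l j by (simp add: \<phi>_def)
    show "\<psi> (\<phi> (j, i, U)) = (j, i, U)"
      using max card notin by (auto simp: \<psi>_def) (auto simp: \<phi>_def)
    have "y - x \<notin> Q" if "x \<in> \<phi> (j, i, U)" "y \<in> \<phi> (j, i, U)" for x y
    proof -
      have "1 \<le> x" "y \<le> l + 1 + j" using that U(1) j l by (auto simp: \<phi>_def)
      then have "y - x \<le> q - r" using j by simp
      \<comment> \<open>The bounds \<open>l + 1\<close> and \<open>j + 1\<close> on \<open>U\<close>
        keep it at distance at least \<open>l\<close> from both 1 and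
        \<open>l + 1 + j\<close>.\<close>
      moreover have "y - x \<notin> {1..l - 1}"
      proof (cases "x \<in> U \<and> y \<in> U")
        case False
        then show ?thesis using that U(1) j l by (auto simp: \<phi>_def)
      qed (use sep in blast)
      ultimately show ?thesis by (auto simp: Q)
    qed
    moreover have "\<phi> (j, i, U) \<subseteq> {1..q + 1}" using U(1) j l r q by (auto simp: \<phi>_def)
    moreover have "\<phi> (j, i, U) \<noteq> {1}" using l j by (auto simp: \<phi>_def)
    ultimately show "\<phi> (j, i, U) \<in> heads - {{1}}" by (auto simp: heads_def \<phi>_def)
  qed
  have \<psi>: "\<psi> H \<in> X" "\<phi> (\<psi> H) = H" if H: "H \<in> heads - {{1}}" for H
  proof -
    have "H \<in> heads" using H by simp
    note h = headsD[OF this]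
    have "1 \<in> H" and sep: "\<And>x y. x \<in> H \<Longrightarrow> y \<in> H \<Longrightarrow> y - x \<notin> Q"
      using H by (auto simp: heads_def)
    have gap: "l \<le> y - x" if "x \<in> H" "y \<in> H" "x < y" for x y
      using sep[OF that(1,2)] that(3) by (auto simp: Q)
    have "Max H \<noteq> 1"
    proof
      assume "Max H = 1"
      then have "H = {1}" using h(3) \<open>1 \<in> H\<close> by force
      then show False using H by simp
    qed
    then have "1 < Max H" using h(3)[OF h(2)] by simp
    define j where "j = Max H - l - 1"
    define i where "i = int (card H) - 2"
    have j: "0 \<le> j" "j \<le> q - l - r"
      using gap[OF \<open>1 \<in> H\<close> h(2) \<open>1 < Max H\<close>] h(4) by (auto simp: j_def)
    have "card {1, Max H} = 2" using \<open>1 < Max H\<close> by simp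
    moreover have sub: "{1, Max H} \<subseteq> H" using \<open>1 \<in> H\<close> h by simp
    ultimately have card: "int (card (H - {1, Max H})) = i" "0 \<le> i"
      using h(1) card_mono[OF h(1) sub] by (auto simp: card_Diff_subset i_def)
    have "H - {1, Max H} \<subseteq> {l + 1..j + 1}"
    proof
      fix x assume x: "x \<in> H - {1, Max H}"
      have "1 < x" "x < Max H" using x h(3)[of x] by (auto simp: order_less_le)
      then show "x \<in> {l + 1..j + 1}"
        using x gap[of 1 x] gap[of x "Max H"] \<open>1 \<in> H\<close> h(2) by (simp add: j_def)
    qed
    moreover have "y - x \<notin> {1..l - 1}" if "x \<in> H" "y \<in> H" for x y
      using sep[OF that] by (simp add: Q)
    ultimately have U: "H - {1, Max H} \<in> ?U j i"
      using card by (simp add: indep_def)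
    \<comment> \<open>For larger \<open>i\<close> the binomial counting the possible
      \<open>U\<close> is 0, but a \<open>U\<close> is at hand.\<close>
    have "i \<le> j div l"
    proof (rule ccontr)
      assume "\<not> i \<le> j div l"
      then have "card (?U j i) \<noteq> 0" "1 \<le> i" "j < l * i"
        using U finite_indep[of "{l + 1..j + 1}"] l j pos_imp_zdiv_nonneg_iff[of l j]
        by (auto intro!: less_mult_if_div_less)
      then show False using cardU[OF j(1) card(2)] gap_binomial_eq_0[of i j l] by simp
    qed
    then show "\<psi> H \<in> X" using U j card(2)
      by (simp add: X_def \<psi>_def j_def[symmetric] i_def[symmetric])
    show "\<phi> (\<psi> H) = H" using \<open>1 \<in> H\<close> h(2) by (auto simp: \<phi>_def \<psi>_def)
  qed
  have "(\<Sum>H\<in>heads - {{1}}. g (Max H) (int (card H))) = (\<Sum>(j, i, U)\<in>X. g (l + 1 + j) (i + 2))"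
  proof (rule sum.reindex_bij_witness[where i = \<phi> and j = \<psi>])
    show "(case \<psi> H of (j, i, U) \<Rightarrow> g (l + 1 + j) (i + 2)) = g (Max H) (int (card H))" for H
      by (simp add: \<psi>_def)
    show "\<phi> t \<in> heads - {{1}}" "\<psi> (\<phi> t) = t" if "t \<in> X" for t
      using \<phi>(3,4) that by (cases t; simp)+
  qed (rule \<psi>; assumption)+
  also have "\<dots> = (\<Sum>j = 0..q - l - r. \<Sum>i = 0..j div l. \<Sum>U\<in>?U j i. g (l + 1 + j) (i + 2))"
    unfolding X_def by (subst sum.Sigma[symmetric]; (subst sum.Sigma)?) (auto simp: finite_indep)
  also have "\<dots> = (\<Sum>j = 0..q - l - r. \<Sum>i = 0..j div l.
      int (nat (j - (l - 1) * i) choose nat i) * g (l + 1 + j) (i + 2))"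
    by (intro sum.cong refl) (simp add: cardU)
  finally have main: "(\<Sum>H\<in>heads - {{1}}. g (Max H) (int (card H))) = \<dots>" .
  have "{1} \<in> heads" using q Q_props(3) by (auto simp: heads_def)
  then show ?thesis using main by (simp add: sum.remove[OF finite_heads])
qed

section \<open>The two recurrences\<close>

lemma Bk_rec:
  "Bk Q n k = of_bool (n = 0 \<and> k = 0) + Bk Q (n - 1) k + Bk Q (n - q - 1) (k - 1)
    + (\<Sum>j = 0..q - l - r. \<Sum>i = 0..j div l.
         int (nat (j - (l - 1) * i) choose nat i) * Bk Q (n - l - q - 1 - j) (k - 2 - i))"
proof (cases "1 \<le> n")
  case True
  then show ?thesis
    using Bk_eq_sum_heads[OF True, of k] sum_heads[of "\<lambda>a s. Bk Q (n - q - a) (k - s)"]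
    by (simp add: algebra_simps)
next
  \<comment> \<open>For \<open>n \<le> 0\<close> all boards on the right have negative length, and
    the empty tiling of the 0-board is the delta term.\<close>
  case False
  have "Bk Q n k = of_bool (n = 0 \<and> k = 0)"
    using False q
    by (cases "n = 0") (simp_all add: Bk_eq_card_indep[OF Q_props(1-3)] Q_props(4) indep_empty Bk_def[of Q n])
  moreover have "Bk Q n' k' = 0" if "n' < 0" for n' k' using that by (simp add: Bk_def)
  ultimately show ?thesis using False q l by simp
qed

lemma B_rec:
  "B Q n = of_bool (n = 0) + B Q (n - 1) + B Q (n - q - 1)
    + (\<Sum>j = 0..q - l - r. fseq l j * B Q (n - l - q - 1 - j))"
proof -
  let ?C = "\<lambda>j i. int (nat (j - (l - 1) * i) choose nat i)"
  let ?R = "\<lambda>k. \<Sum>j = 0..q - l - r. \<Sum>i = 0..j div l. ?C j i * Bk Q (n - l - q - 1 - j) (k - 2 - i)"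
  note shift = sum_Bk_shift[OF Q_props(1-3)]
  have "(\<Sum>k = 0..n. ?R k)
      = (\<Sum>j = 0..q - l - r. \<Sum>i = 0..j div l. ?C j i * (\<Sum>k = 0..n. Bk Q (n - l - q - 1 - j) (k - (2 + i))))"
  proof (subst sum.swap, rule sum.cong[OF refl])
    fix j
    show "(\<Sum>k = 0..n. \<Sum>i = 0..j div l. ?C j i * Bk Q (n - l - q - 1 - j) (k - 2 - i))
        = (\<Sum>i = 0..j div l. ?C j i * (\<Sum>k = 0..n. Bk Q (n - l - q - 1 - j) (k - (2 + i))))"
      by (subst sum.swap) (simp add: sum_distrib_left diff_diff_eq)
  qed
  also have "\<dots> = (\<Sum>j = 0..q - l - r. \<Sum>i = 0..j div l. ?C j i * B Q (n - l - q - 1 - j))"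
  proof (intro sum.cong refl)
    \<comment> \<open>The range \<open>{0..n}\<close> of \<open>k\<close> still captures all tilings
      after the shift by \<open>2 + i\<close>: since \<open>i \<le> j div l \<le> j\<close>, the
      board length \<open>n - l - q - 1 - j\<close> is at most \<open>n - (2 + i)\<close>.\<close>
    fix j i assume j: "j \<in> {0..q - l - r}" and i: "i \<in> {0..j div l}"
    have "j div l \<le> j" using l j zdiv_mono2[of j 1 l] by auto
    then show "?C j i * (\<Sum>k = 0..n. Bk Q (n - l - q - 1 - j) (k - (2 + i))) = ?C j i * B Q (n - l - q - 1 - j)"
      using i j l q by (subst shift) auto
  qed
  also have "\<dots> = (\<Sum>j = 0..q - l - r. fseq l j * B Q (n - l - q - 1 - j))"
    by (intro sum.cong refl) (simp add: fseq_eq_sum[OF l] sum_distrib_right)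
  finally have R: "(\<Sum>k = 0..n. ?R k) = (\<Sum>j = 0..q - l - r. fseq l j * B Q (n - l - q - 1 - j))" .
  have "B Q n = (\<Sum>k = 0..n. Bk Q n k)" by (simp add: sum_Bk[OF Q_props(1-3)])
  also have "\<dots> = (\<Sum>k = 0..n. of_bool (n = 0 \<and> k = 0)) + (\<Sum>k = 0..n. Bk Q (n - 1) k)
      + (\<Sum>k = 0..n. Bk Q (n - q - 1) (k - 1)) + (\<Sum>k = 0..n. ?R k)"
    by (subst Bk_rec) (simp only: sum.distrib)
  also have "(\<Sum>k = 0..n. of_bool (n = 0 \<and> k = 0)) = (of_bool (n = 0) :: int)"
    by (cases "n = 0") auto
  also have "(\<Sum>k = 0..n. Bk Q (n - 1) k) = B Q (n - 1)"
    using shift[of 0 "n - 1" n] by simp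
  also have "(\<Sum>k = 0..n. Bk Q (n - q - 1) (k - 1)) = B Q (n - q - 1)"
    using q by (intro shift) auto
  finally show ?thesis by (simp only: R)
qed

end

theorem theorem3:
  fixes q l r :: int and Q :: "int set"
  assumes "q \<ge> 1" and "l \<ge> 1" and "2 * r \<ge> q" and "q + 1 \<ge> l + r"
    and "Q = {1..l - 1} \<union> {q - r + 1..q}"
  shows "(\<forall>n. B Q n = of_bool (n = 0) + B Q (n - 1) + B Q (n - q - 1)
            + (\<Sum>j = 0..q - l - r. fseq l j * B Q (n - l - q - 1 - j)))
       \<and> (\<forall>n k. Bk Q n k = of_bool (n = 0 \<and> k = 0) + Bk Q (n - 1) k + Bk Q (n - q - 1) (k - 1)
            + (\<Sum>j = 0..q - l - r. \<Sum>i = 0..j div l.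
                 int (nat (j - (l - 1) * i) choose nat i) * Bk Q (n - l - q - 1 - j) (k - 2 - i)))"
  using B_rec[OF assms] Bk_rec[OF assms] by blast

end
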